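(* Let $\alpha,\beta\in(0,1]$, let $A,B\in\mathbb{R}$, and let $L=L(t,u,v,w):\mathbb{T}^\kappa\times\mathbb{R}\times\mathbb{R}\times\mathbb{R}\to\mathbb{R}$ be a function whose second-order partial derivatives $L_{uu},L_{uv},L_{uw},L_{vw},L_{vv},L_{ww}$ exist and are continuous. Consider the problem $$\mathcal{L}(y)=\int_{a}^{b}L\bigl(t,y^{\sigma}(t),{}_a\Delta_h^\alpha y(t),{}_h\Delta_b^\beta y(t)\bigr)\Delta t\longrightarrow\min,\qquad y(a)=A,\ y(b)=B,$$ over functions $y:\mathbb{T}\to\mathbb{R}$. If $\hat{y}:\mathbb{T}\to\mathbb{R}$ is a local minimum for this problem, then $$L_u[\hat{y}](t)+\bigl({}_h\Delta_{\rho(b)}^\alpha L_v[\hat{y}]\bigr)(t)+\bigl({}_a\Delta_h^\beta L_w[\hat{y}]\bigr)(t)=0$$ for all $t\in\mathbb{T}^{\kappa^2}$, where $[y](s)=\bigl(s,y^{\sigma}(s),{}_a\Delta_h^\alpha y(s),{}_h\Delta_b^\beta y(s)\bigr)$ for $s\in\mathbb{T}^\kappa$.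
   Context: Let $a\in\mathbb{R}$, $h>0$, $b=a+kh$ with $k\in\mathbb{N}$, $k\ge 1$, and $\mathbb{T}=\{a,a+h,\dots,b\}$, $\mathbb{T}^\kappa=\{a,a+h,\dots,b-h\}$, $\mathbb{T}^{\kappa^2}=\{a,\dots,b-2h\}$ (empty if $k=1$). Put $\sigma(t)=t+h$, $\rho(t)=t-h$, $f^\sigma(t)=f(\sigma(t))$. The delta derivative is $f^\Delta(t)=\frac{f(t+h)-f(t)}{h}$. The delta integral is $\int_c^d f(t)\Delta t=\sum_{i=0}^{(d-c)/h-1}f(c+ih)\,h$ for $d-c\in h\mathbb{N}_0$ (equal to $0$ if $c=d$). The $h$-factorial function is $x_h^{(y)}:=h^y\,\Gamma(\frac{x}{h}+1)/\Gamma(\frac{x}{h}+1-y)$ for $x,y\in\mathbb{R}$, with the convention that division at a pole yields zero. Fractional $h$-sums. Let $\nu>0$. For a function $f$ on a grid $\{a,a+h,\dots,c\}$ (with $c=b$ or $c=\rho(b)$) and $t$ in this grid, $${}_a\Delta_h^{-\nu}f(t+\nu h)=\frac{1}{\Gamma(\nu)}\sum_{s\in\{a,a+h,\dots,t\}}(t+\nu h-\sigma(s))_h^{(\nu-1)}f(s)\,h,$$ $${}_h\Delta_c^{-\nu}f(t-\nu h)=\frac{1}{\Gamma(\nu)}\sum_{s\in\{t,t+h,\dots,c\}}(s+\nu h-\sigma(t))_h^{(\nu-1)}f(s)\,h,$$ and for $\nu=0$: ${}_a\Delta_h^{0}f(t)={}_h\Delta_c^{0}f(t)=f(t)$. Fractional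 differences. For $0<\alpha\le1$ and $\gamma=1-\alpha$, the left and right fractional differences are ${}_a\Delta_h^\alpha f(t):=\bigl({}_a\Delta_h^{-\gamma}f(t+\gamma h)\bigr)^\Delta$ and ${}_h\Delta_c^\alpha f(t):=-\bigl({}_h\Delta_c^{-\gamma}f(t-\gamma h)\bigr)^\Delta$, where the delta derivative is taken of the functions $t\mapsto {}_a\Delta_h^{-\gamma}f(t+\gamma h)$ and $t\mapsto{}_h\Delta_c^{-\gamma}f(t-\gamma h)$; they are defined for $t\in\{a,\dots,c-h\}$. (Same definitions with $\beta$ in place of $\alpha$.) The functions $L_v[\hat y]$, $L_w[\hat y]$ are defined on $\mathbb{T}^\kappa$, so that ${}_h\Delta_{\rho(b)}^\alpha L_v[\hat{y}]$ and ${}_a\Delta_h^\beta L_w[\hat{y}]$ (applied on the grid with $c=\rho(b)$) are defined on $\mathbb{T}^{\kappa^2}$. Local minimum. For $f:\mathbb{T}\to\mathbb{R}$ put $\|f\|=\max_{t\in\mathbb{T}^\kappa}|f^\sigma(t)|+\max_{t\in\mathbb{T}^\kappa}|{}_a\Delta_h^\alpha f(t)|+\max_{t\in\mathbb{T}^\kappa}|{}_h\Delta_b^\beta f(t)|$. A function $\hat{y}:\mathbb{T}\to\mathbb{R}$ with $\hat y(a)=A$, $\hat y(b)=B$ is a local minimum for the problem if there is $\delta>0$ such that $\mathcal{L}(\hat y)\le\mathcal{L}(y)$ for all $y:\mathbb{T}\to\mathbb{R}$ with $y(a)=A$, $y(b)=B$ and $\|y-\hat y\|<\delta$. Subscripts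 $u,v,w$ on $L$ denote partial derivatives with respect to the second, third and fourth arguments. *)

theory Defs
  imports "HOL-Analysis.Analysis"
begin

section \<open>The time scale and its delta calculus\<close>

text \<open>The grid \<open>{c, c + h, \<dots>, d}\<close> for \<open>d - c \<in> h\<nat>\<^sub>0\<close>; it is empty when \<open>d < c\<close>.
  With \<open>b = a + k h\<close>, the sets \<open>\<T>\<close>, \<open>\<T>\<^sup>\<kappa>\<close> and \<open>\<T>\<^sup>\<kappa>\<^sup>2\<close> are \<open>hgrid h a b\<close>, \<open>hgrid h a (bwd h b)\<close>
  and \<open>hgrid h a (bwd h (bwd h b))\<close>. Functions on a grid are represented by functions on
  \<open>real\<close> of which only the values on the grid are used.\<close>

definition hgrid :: "real \<Rightarrow> real \<Rightarrow> real \<Rightarrow> real set" where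
  "hgrid h c d = {t. t \<le> d \<and> (\<exists>n::nat. t = c + real n * h)}"

definition fwd :: "real \<Rightarrow> real \<Rightarrow> real" where
  "fwd h t = t + h"

definition bwd :: "real \<Rightarrow> real \<Rightarrow> real" where
  "bwd h t = t - h"

definition delta_deriv :: "real \<Rightarrow> (real \<Rightarrow> real) \<Rightarrow> real \<Rightarrow> real" where
  "delta_deriv h f t = (f (fwd h t) - f t) / h"

definition delta_integral :: "real \<Rightarrow> real \<Rightarrow> real \<Rightarrow> (real \<Rightarrow> real) \<Rightarrow> real" where
  "delta_integral h c d f = (\<Sum>i<nat \<lfloor>(d - c) / h\<rfloor>. f (c + real i * h) * h)"

section \<open>Fractional sums and differences\<close>

text \<open>\<open>Gamma\<close> is \<open>0\<close> at its poles and \<open>x / 0 = 0\<close>, so division at a pole yields zero.\<close>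

definition hfact :: "real \<Rightarrow> real \<Rightarrow> real \<Rightarrow> real" where
  "hfact h x y = h powr y * (Gamma (x / h + 1) / Gamma (x / h + 1 - y))"

text \<open>The fractional sums are functions of the shifted argument: \<open>x = t + \<nu> h\<close> for the left
  sum and \<open>x = t - \<nu> h\<close> for the right sum, with \<open>t\<close> in the grid.\<close>

definition left_hsum :: "real \<Rightarrow> real \<Rightarrow> real \<Rightarrow> (real \<Rightarrow> real) \<Rightarrow> real \<Rightarrow> real" where
  "left_hsum h a \<nu> f x =
     (if \<nu> = 0 then f x
      else let t = x - \<nu> * h in
        1 / Gamma \<nu> * (\<Sum>s\<in>hgrid h a t. hfact h (t + \<nu> * h - fwd h s) (\<nu> - 1) * f s * h))"

definition right_hsum :: "real \<Rightarrow> real \<Rightarrow> real \<Rightarrow> (real \<Rightarrow> real) \<Rightarrow> real \<Rightarrow> real" where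
  "right_hsum h c \<nu> f x =
     (if \<nu> = 0 then f x
      else let t = x + \<nu> * h in
        1 / Gamma \<nu> * (\<Sum>s\<in>hgrid h t c. hfact h (s + \<nu> * h - fwd h t) (\<nu> - 1) * f s * h))"

definition left_hdiff :: "real \<Rightarrow> real \<Rightarrow> real \<Rightarrow> (real \<Rightarrow> real) \<Rightarrow> real \<Rightarrow> real" where
  "left_hdiff h a \<alpha> f t =
     delta_deriv h (\<lambda>r. left_hsum h a (1 - \<alpha>) f (r + (1 - \<alpha>) * h)) t"

definition right_hdiff :: "real \<Rightarrow> real \<Rightarrow> real \<Rightarrow> (real \<Rightarrow> real) \<Rightarrow> real \<Rightarrow> real" where
  "right_hdiff h c \<alpha> f t =
     - delta_deriv h (\<lambda>r. right_hsum h c (1 - \<alpha>) f (r - (1 - \<alpha>) * h)) t"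

section \<open>Lagrangians\<close>

type_synonym lagrangian = "real \<Rightarrow> real \<Rightarrow> real \<Rightarrow> real \<Rightarrow> real"

definition d_u :: "lagrangian \<Rightarrow> lagrangian" where
  "d_u F = (\<lambda>t u v w. deriv (\<lambda>x. F t x v w) u)"

definition d_v :: "lagrangian \<Rightarrow> lagrangian" where
  "d_v F = (\<lambda>t u v w. deriv (\<lambda>x. F t u x w) v)"

definition d_w :: "lagrangian \<Rightarrow> lagrangian" where
  "d_w F = (\<lambda>t u v w. deriv (\<lambda>x. F t u v x) w)"

text \<open>Existence of the partial derivatives on \<open>D \<times> \<real> \<times> \<real> \<times> \<real>\<close>.\<close>

definition ex_u :: "real set \<Rightarrow> lagrangian \<Rightarrow> bool" where
  "ex_u D F \<longleftrightarrow> (\<forall>t\<in>D. \<forall>u v w. (\<lambda>x. F t x v w) differentiable (at u))"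

definition ex_v :: "real set \<Rightarrow> lagrangian \<Rightarrow> bool" where
  "ex_v D F \<longleftrightarrow> (\<forall>t\<in>D. \<forall>u v w. (\<lambda>x. F t u x w) differentiable (at v))"

definition ex_w :: "real set \<Rightarrow> lagrangian \<Rightarrow> bool" where
  "ex_w D F \<longleftrightarrow> (\<forall>t\<in>D. \<forall>u v w. (\<lambda>x. F t u v x) differentiable (at w))"

definition cont_lagr :: "real set \<Rightarrow> lagrangian \<Rightarrow> bool" where
  "cont_lagr D F \<longleftrightarrow> continuous_on (D \<times> UNIV) (\<lambda>(t, u, v, w). F t u v w)"

text \<open>Subscripts are read from left to right: \<open>L\<^sub>u\<^sub>v\<close> is the derivative of \<open>L\<^sub>u\<close> in \<open>v\<close>.\<close>

definition cont_second_partials :: "real set \<Rightarrow> lagrangian \<Rightarrow> bool" where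
  "cont_second_partials D L \<longleftrightarrow>
     ex_u D L \<and> ex_v D L \<and> ex_w D L \<and>
     ex_u D (d_u L) \<and> cont_lagr D (d_u (d_u L)) \<and>
     ex_v D (d_u L) \<and> cont_lagr D (d_v (d_u L)) \<and>
     ex_w D (d_u L) \<and> cont_lagr D (d_w (d_u L)) \<and>
     ex_w D (d_v L) \<and> cont_lagr D (d_w (d_v L)) \<and>
     ex_v D (d_v L) \<and> cont_lagr D (d_v (d_v L)) \<and>
     ex_w D (d_w L) \<and> cont_lagr D (d_w (d_w L))"

section \<open>The variational problem\<close>

text \<open>\<open>along h a b \<alpha> \<beta> F y t\<close> is \<open>F[y](t)\<close>.\<close>

definition along ::
  "real \<Rightarrow> real \<Rightarrow> real \<Rightarrow> real \<Rightarrow> real \<Rightarrow> lagrangian \<Rightarrow> (real \<Rightarrow> real) \<Rightarrow> real \<Rightarrow> real" where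
  "along h a b \<alpha> \<beta> F y t = F t (y (fwd h t)) (left_hdiff h a \<alpha> y t) (right_hdiff h b \<beta> y t)"

definition functional ::
  "real \<Rightarrow> real \<Rightarrow> real \<Rightarrow> real \<Rightarrow> real \<Rightarrow> lagrangian \<Rightarrow> (real \<Rightarrow> real) \<Rightarrow> real" where
  "functional h a b \<alpha> \<beta> L y = delta_integral h a b (along h a b \<alpha> \<beta> L y)"

definition hnorm :: "real \<Rightarrow> real \<Rightarrow> real \<Rightarrow> real \<Rightarrow> real \<Rightarrow> (real \<Rightarrow> real) \<Rightarrow> real" where
  "hnorm h a b \<alpha> \<beta> f =
     Max ((\<lambda>t. \<bar>f (fwd h t)\<bar>) ` hgrid h a (bwd h b)) +
     Max ((\<lambda>t. \<bar>left_hdiff h a \<alpha> f t\<bar>) ` hgrid h a (bwd h b)) +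
     Max ((\<lambda>t. \<bar>right_hdiff h b \<beta> f t\<bar>) ` hgrid h a (bwd h b))"

definition local_minimum ::
  "real \<Rightarrow> real \<Rightarrow> real \<Rightarrow> real \<Rightarrow> real \<Rightarrow> lagrangian \<Rightarrow> real \<Rightarrow> real \<Rightarrow> (real \<Rightarrow> real) \<Rightarrow> bool" where
  "local_minimum h a b \<alpha> \<beta> L A B yhat \<longleftrightarrow>
     yhat a = A \<and> yhat b = B \<and>
     (\<exists>\<delta>>0. \<forall>y. y a = A \<and> y b = B \<and> hnorm h a b \<alpha> \<beta> (\<lambda>t. y t - yhat t) < \<delta> \<longrightarrow>
        functional h a b \<alpha> \<beta> L yhat \<le> functional h a b \<alpha> \<beta> L y)"

end

theory Submission
  imports Defs
begin

text \<open>Enumerate the grid as \<open>t\<^sub>n = a + n h\<close>. Both fractional differences are then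
  discrete convolutions with one and the same weight sequence \<open>d\<^sub>\<alpha>\<close>
  (\<open>left_hdiff_eq\<close>, \<open>right_hdiff_eq\<close>): the left difference of order \<open>\<alpha>\<close> at \<open>t\<^sub>n\<close> sums
  \<open>d\<^sub>\<alpha>(n + 1 - i) f(t\<^sub>i)\<close> over \<open>i \<le> n + 1\<close>, and the right one sums \<open>d\<^sub>\<alpha>(i - n) f(t\<^sub>i)\<close> over
  \<open>i \<ge> n\<close> up to the end of the grid. So, apart from an index shift by one, left and right
  differences are transposed matrices. This is fractional summation by parts.

  For \<open>t = t\<^sub>m\<close> in \<open>\<T>\<^sup>\<kappa>\<^sup>2\<close> the point \<open>t\<^sub>m\<^sub>+\<^sub>1\<close> is interior, so the function \<open>\<eta>\<close> that is \<open>1\<close> there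
  and \<open>0\<close> at the other grid points is an admissible variation. Since \<open>\<parallel>e \<eta>\<parallel> = \<bar>e\<bar> \<parallel>\<eta>\<parallel>\<close>, the
  real function \<open>e \<mapsto> \<L>(yhat + e \<eta>)\<close> at the minimizer \<open>yhat\<close> has a local minimum at \<open>0\<close>, so its
  derivative vanishes (\<open>first_variation_eq_0\<close>). That derivative is \<open>h\<close> times the sum over
  \<open>n < k\<close> of \<open>L\<^sub>u \<eta>(t\<^sub>n\<^sub>+\<^sub>1)\<close>, \<open>L\<^sub>v\<close> times the left difference of \<open>\<eta>\<close> and \<open>L\<^sub>w\<close> times the right
  difference of \<open>\<eta>\<close> (\<open>DERIV_functional\<close>). The first sum is \<open>L\<^sub>u\<close> at \<open>t\<^sub>m\<close>; as \<open>\<eta>\<close> picks one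
  column of each matrix, transposition turns the other two into the right difference of
  \<open>L\<^sub>v\<close> and the left difference of \<open>L\<^sub>w\<close> at \<open>t\<^sub>m\<close> (\<open>sum_times_left_hdiff_bump\<close>,
  \<open>sum_times_right_hdiff_bump\<close>).

  What needs care is the chain rule, which calls for total differentiability of \<open>L\<close> in
  \<open>(u, v, w)\<close>. Not all mixed second derivatives are given, but the given ones suffice when
  the increments are taken in a suitable order (\<open>has_derivative_lagrangian\<close>).\<close>

section \<open>Total differentiability of the Lagrangian\<close>

text \<open>The increment splits into a step in \<open>y\<close>, governed by the mean value theorem and the
  continuity of \<open>g\<close>, and a step in \<open>x\<close> with \<open>y\<close> fixed, for which differentiability at the
  single point is enough. This asymmetry between the two variables is what the later proofs
  exploit.\<close>

lemma has_derivative_scalar_partialsI: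
  fixes f :: "'a::real_normed_vector \<Rightarrow> real \<Rightarrow> real"
  assumes fx: "((\<lambda>x. f x y) has_derivative f') (at x)"
    and fy: "\<And>x y. ((\<lambda>y. f x y) has_real_derivative g x y) (at y)"
    and cont: "continuous_on UNIV (\<lambda>(x, y). g x y)"
  shows "((\<lambda>(x, y). f x y) has_derivative (\<lambda>(p, q). f' p + g x y * q)) (at (x, y))"
proof -
  have "((\<lambda>(x, y). f x y) has_derivative
      (\<lambda>(p, q). f' p + blinfun_apply (blinfun_mult_right (g x y)) q)) (at (x, y) within UNIV \<times> UNIV)"
  proof (rule has_derivative_partialsI)
    show "((\<lambda>x. f x y) has_derivative f') (at x within UNIV)" using fx by simp
    show "((\<lambda>y. f x y) has_derivative blinfun_apply (blinfun_mult_right (g x y))) (at y within UNIV)" for x y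
      using fy[of x y] by (simp add: has_field_derivative_def)
    have "isCont (\<lambda>z. blinfun_mult_right (case z of (x, y) \<Rightarrow> g x y)) (x, y)"
      using cont by (intro bounded_linear.isCont[OF bounded_linear_blinfun_mult_right])
        (simp add: continuous_on_eq_continuous_at)
    then show "continuous (at (x, y) within UNIV \<times> UNIV) (\<lambda>(x, y). blinfun_mult_right (g x y))"
      by (simp add: case_prod_unfold)
  qed auto
  then show ?thesis by simp
qed

text \<open>The variables are ordered by how much is known: the derivative in \<open>u\<close> is jointly
  continuous, the one in \<open>v\<close> is continuous in \<open>(v, w)\<close> for the given \<open>u\<close>, and the one in \<open>w\<close>
  merely exists at the point. The arguments are paired as \<open>((w, v), u)\<close> so that
  the two-variable rule applies twice, adding \<open>v\<close> to \<open>w\<close> and then \<open>u\<close> to both.\<close>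

lemma has_derivative_three_partialsI:
  fixes F :: "real \<Rightarrow> real \<Rightarrow> real \<Rightarrow> real"
  assumes Fu: "\<And>u v w. ((\<lambda>x. F x v w) has_real_derivative Fu u v w) (at u)"
    and Fv: "\<And>v w. ((\<lambda>x. F u x w) has_real_derivative Fv v w) (at v)"
    and Fw: "((\<lambda>x. F u v x) has_real_derivative Fw) (at w)"
    and cont_u: "continuous_on UNIV (\<lambda>((w, v), u). Fu u v w)"
    and cont_v: "continuous_on UNIV (\<lambda>(w, v). Fv v w)"
  shows "((\<lambda>((w, v), u). F u v w) has_derivative
      (\<lambda>((r, q), p). Fw * r + Fv v w * q + Fu u v w * p)) (at ((w, v), u))"
proof -
  have "((\<lambda>(w, v). F u v w) has_derivative (\<lambda>(r, q). Fw * r + Fv v w * q)) (at (w, v))"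
    using Fw Fv cont_v by (intro has_derivative_scalar_partialsI) (auto simp: has_field_derivative_def)
  then have "((\<lambda>(z, u). (case z of (w, v) \<Rightarrow> F u v w)) has_derivative
      (\<lambda>(z, p). (case z of (r, q) \<Rightarrow> Fw * r + Fv v w * q) + (case (w, v) of (w, v) \<Rightarrow> Fu u v w) * p))
      (at ((w, v), u))"
    using Fu cont_u
    by (intro has_derivative_scalar_partialsI[where g = "\<lambda>z u. case z of (w, v) \<Rightarrow> Fu u v w"])
      (auto simp: case_prod_unfold)
  then show ?thesis by (simp add: case_prod_unfold)
qed

lemma continuous_on_cont_lagr:
  assumes "cont_lagr D F" "t \<in> D"
  shows "continuous_on UNIV (\<lambda>((w, v), u). F t u v w)"
    and "continuous_on UNIV (\<lambda>(w, v). F t u v w)"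
proof -
  have c: "continuous_on (D \<times> UNIV) (\<lambda>(t, u, v, w). F t u v w)"
    using assms by (simp add: cont_lagr_def)
  have "continuous_on UNIV (\<lambda>z. (t, snd z, snd (fst z), fst (fst z)))"
    by (intro continuous_intros)
  from continuous_on_compose2[OF c this] show "continuous_on UNIV (\<lambda>((w, v), u). F t u v w)"
    using assms(2) by (auto simp: case_prod_unfold)
  have "continuous_on UNIV (\<lambda>z. (t, u, snd z, fst z))"
    by (intro continuous_intros)
  from continuous_on_compose2[OF c this] show "continuous_on UNIV (\<lambda>(w, v). F t u v w)"
    using assms(2) by (auto simp: case_prod_unfold)
qed

lemma DERIV_d_u: "ex_u D F \<Longrightarrow> t \<in> D \<Longrightarrow> ((\<lambda>x. F t x v w) has_real_derivative d_u F t u v w) (at u)"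
  by (simp add: ex_u_def d_u_def DERIV_deriv_iff_real_differentiable)

lemma DERIV_d_v: "ex_v D F \<Longrightarrow> t \<in> D \<Longrightarrow> ((\<lambda>x. F t u x w) has_real_derivative d_v F t u v w) (at v)"
  by (simp add: ex_v_def d_v_def DERIV_deriv_iff_real_differentiable)

lemma DERIV_d_w: "ex_w D F \<Longrightarrow> t \<in> D \<Longrightarrow> ((\<lambda>x. F t u v x) has_real_derivative d_w F t u v w) (at w)"
  by (simp add: ex_w_def d_w_def DERIV_deriv_iff_real_differentiable)

text \<open>\<open>L\<^sub>u\<close> has continuous derivatives in \<open>u\<close>, \<open>v\<close> and \<open>w\<close>, hence is differentiable
  and so jointly continuous. Of \<open>L\<^sub>v\<close> only the derivatives in \<open>v\<close> and \<open>w\<close> are controlled, which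
  gives continuity in \<open>(v, w)\<close> with \<open>u\<close> fixed. These two facts are
  exactly the continuity that \<open>has_derivative_three_partialsI\<close> demands for \<open>L\<close>. The same rule,
  applied to \<open>L\<^sub>u\<close>, has already given the first of them.\<close>

lemma has_derivative_lagrangian:
  assumes L: "cont_second_partials D L" and t: "t \<in> D"
  shows "((\<lambda>((w, v), u). L t u v w) has_derivative
      (\<lambda>((r, q), p). d_w L t u v w * r + d_v L t u v w * q + d_u L t u v w * p)) (at ((w, v), u))"
proof (rule has_derivative_three_partialsI)
  note L' = L[unfolded cont_second_partials_def]
  show "((\<lambda>x. L t x v w) has_real_derivative d_u L t u v w) (at u)" for u v w
    using L' t by (auto intro: DERIV_d_u)
  show "((\<lambda>x. L t u x w) has_real_derivative d_v L t u v w) (at v)" for v w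
    using L' t by (auto intro: DERIV_d_v)
  show "((\<lambda>x. L t u v x) has_real_derivative d_w L t u v w) (at w)"
    using L' t by (auto intro: DERIV_d_w)
  have "((\<lambda>((w, v), u). d_u L t u v w) has_derivative
      (\<lambda>((r, q), p). d_w (d_u L) t u v w * r + d_v (d_u L) t u v w * q + d_u (d_u L) t u v w * p))
      (at ((w, v), u))" for u v w
    using L' t
    by (intro has_derivative_three_partialsI DERIV_d_u DERIV_d_v DERIV_d_w continuous_on_cont_lagr) auto
  then have "isCont (\<lambda>((w, v), u). d_u L t u v w) z" for z
    by (cases z) (metis has_derivative_continuous surj_pair)
  then show "continuous_on UNIV (\<lambda>((w, v), u). d_u L t u v w)"
    by (simp add: continuous_on_eq_continuous_at)
  have "((\<lambda>(w, v). d_v L t u v w) has_derivative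
      (\<lambda>(r, q). d_w (d_v L) t u v w * r + d_v (d_v L) t u v w * q)) (at (w, v))" for v w
    using L' t DERIV_d_w[of D "d_v L" t u v w]
    by (intro has_derivative_scalar_partialsI DERIV_d_v continuous_on_cont_lagr)
       (auto simp: has_field_derivative_def)
  then have "isCont (\<lambda>(w, v). d_v L t u v w) z" for z
    by (cases z) (metis has_derivative_continuous)
  then show "continuous_on UNIV (\<lambda>(w, v). d_v L t u v w)"
    by (simp add: continuous_on_eq_continuous_at)
qed

lemma DERIV_lagrangian_line:
  assumes "cont_second_partials D L" and "t \<in> D"
  shows "((\<lambda>e. L t (u + e * p) (v + e * q) (w + e * r)) has_real_derivative
      d_u L t u v w * p + d_v L t u v w * q + d_w L t u v w * r) (at 0)"
proof -
  have path: "((\<lambda>e. ((w + e * r, v + e * q), u + e * p)) has_derivative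
      (\<lambda>e. ((e * r, e * q), e * p))) (at 0)"
    by (auto intro!: derivative_eq_intros)
  have "((\<lambda>e. case ((w + e * r, v + e * q), u + e * p) of ((w, v), u) \<Rightarrow> L t u v w) has_derivative
      (\<lambda>e. case ((e * r, e * q), e * p) of
         ((r, q), p) \<Rightarrow> d_w L t u v w * r + d_v L t u v w * q + d_u L t u v w * p)) (at 0)"
    using has_derivative_lagrangian[OF assms, where u=u and v=v and w=w]
    by (intro has_derivative_compose[OF path]) (simp add: case_prod_unfold)
  then show ?thesis
    by (simp add: has_field_derivative_def) (erule back_subst[where P = "\<lambda>f. (_ has_derivative f) _"],
       auto simp: algebra_simps)
qed

section \<open>Fractional differences as convolutions\<close>

lemma hgrid_eq_image:
  assumes "h > 0"
  shows "hgrid h (a + real n * h) (a + real N * h) = (\<lambda>i. a + real i * h) ` {n..N}"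
proof -
  have "hgrid h (a + real n * h) (a + real N * h) =
      {a + real (n + m) * h | m. a + real (n + m) * h \<le> a + real N * h}"
    by (auto simp: hgrid_def algebra_simps)
  also have "\<dots> = {a + real (n + m) * h | m. n + m \<le> N}"
    using assms by (simp only: add_le_cancel_left mult_le_cancel_right_pos of_nat_le_iff)
  also have "\<dots> = (\<lambda>i. a + real i * h) ` {n + m | m. n + m \<le> N}"
    by blast
  also have "{n + m | m. n + m \<le> N} = {n..N}"
    by (auto; presburger)
  finally show ?thesis .
qed

lemma hgrid_eq_image_0:
  assumes "h > 0"
  shows "hgrid h a (a + real N * h) = (\<lambda>i. a + real i * h) ` {..N}"
  using hgrid_eq_image[OF assms, of a 0 N] by (simp add: atLeast0AtMost)

lemma bwd_grid_point:
  assumes "k \<ge> 1"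
  shows "bwd h (a + real k * h) = a + real (k - 1) * h"
  using assms by (simp add: bwd_def of_nat_diff algebra_simps)

lemma hgrid_bwd_eq_image:
  assumes "h > 0" and "k \<ge> 1"
  shows "hgrid h a (bwd h (a + real k * h)) = (\<lambda>n. a + real n * h) ` {..<k}"
proof -
  have "{..k - 1} = {..<k}" using assms by auto
  then show ?thesis by (simp only: bwd_grid_point[OF assms(2)] hgrid_eq_image_0[OF assms(1)])
qed

text \<open>The coefficient with which a value at distance \<open>m h\<close> enters a fractional sum of order
  \<open>\<nu>\<close>; for \<open>\<nu> > 0\<close> it is \<open>h\<^sup>\<nu> \<Gamma>(m + \<nu>) / (\<Gamma>(\<nu>) m!)\<close>. For \<open>\<nu> = 0\<close> the sum is the identity, whose
  weights are a Kronecker delta.\<close>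

definition hsum_weight :: "real \<Rightarrow> real \<Rightarrow> nat \<Rightarrow> real" where
  "hsum_weight h \<nu> m = (if \<nu> = 0 then of_bool (m = 0)
     else 1 / Gamma \<nu> * hfact h (real m * h + \<nu> * h - h) (\<nu> - 1) * h)"

text \<open>Taking the delta derivative of a convolution takes the backward difference quotient of
  its weights, extended by \<open>0\<close> to negative indices.\<close>

definition hdiff_weight :: "real \<Rightarrow> real \<Rightarrow> nat \<Rightarrow> real" where
  "hdiff_weight h \<alpha> m =
     (hsum_weight h (1 - \<alpha>) m - (if m = 0 then 0 else hsum_weight h (1 - \<alpha>) (m - 1))) / h"

lemma inj_grid_point: "h > 0 \<Longrightarrow> inj_on (\<lambda>i. a + real i * h) S"
  by (auto simp: inj_on_def)

lemma left_hsum_eq: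
  assumes "h > 0"
  shows "left_hsum h a \<nu> f (a + real n * h + \<nu> * h) =
    (\<Sum>i\<le>n. hsum_weight h \<nu> (n - i) * f (a + real i * h))"
proof (cases "\<nu> = 0")
  case True
  have "(\<Sum>i\<le>n. hsum_weight h \<nu> (n - i) * f (a + real i * h)) =
    (\<Sum>i\<le>n. if i = n then f (a + real i * h) else 0)"
    by (intro sum.cong) (auto simp: hsum_weight_def True)
  then show ?thesis by (simp add: left_hsum_def True)
next
  case False
  have "left_hsum h a \<nu> f (a + real n * h + \<nu> * h) = 1 / Gamma \<nu> *
      (\<Sum>i\<le>n. hfact h (a + real n * h + \<nu> * h - fwd h (a + real i * h)) (\<nu> - 1) * f (a + real i * h) * h)"
    using False assms by (simp add: left_hsum_def hgrid_eq_image_0 sum.reindex inj_grid_point)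
  also have "\<dots> = (\<Sum>i\<le>n. hsum_weight h \<nu> (n - i) * f (a + real i * h))"
    unfolding sum_distrib_left using False
    by (intro sum.cong) (auto simp: hsum_weight_def fwd_def of_nat_diff algebra_simps)
  finally show ?thesis .
qed

lemma right_hsum_eq:
  assumes "h > 0" "n \<le> N"
  shows "right_hsum h (a + real N * h) \<nu> f (a + real n * h - \<nu> * h) =
    (\<Sum>i=n..N. hsum_weight h \<nu> (i - n) * f (a + real i * h))"
proof (cases "\<nu> = 0")
  case True
  have "(\<Sum>i=n..N. hsum_weight h \<nu> (i - n) * f (a + real i * h)) =
    (\<Sum>i=n..N. if i = n then f (a + real i * h) else 0)"
    by (intro sum.cong) (auto simp: hsum_weight_def True)
  then show ?thesis using assms by (simp add: right_hsum_def True)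
next
  case False
  have "right_hsum h (a + real N * h) \<nu> f (a + real n * h - \<nu> * h) = 1 / Gamma \<nu> *
      (\<Sum>i=n..N. hfact h (a + real i * h + \<nu> * h - fwd h (a + real n * h)) (\<nu> - 1) * f (a + real i * h) * h)"
    using False assms by (simp add: right_hsum_def hgrid_eq_image sum.reindex inj_grid_point)
  also have "\<dots> = (\<Sum>i=n..N. hsum_weight h \<nu> (i - n) * f (a + real i * h))"
    unfolding sum_distrib_left using False
    by (intro sum.cong) (auto simp: hsum_weight_def fwd_def of_nat_diff algebra_simps)
  finally show ?thesis .
qed

text \<open>The upper summation limit is \<open>n + 1\<close> because the delta derivative looks one step
  ahead: the value at \<open>t\<^sub>n\<^sub>+\<^sub>1\<close> enters with the weight at distance \<open>0\<close>.\<close>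

lemma left_hdiff_eq:
  assumes "h > 0"
  shows "left_hdiff h a \<alpha> f (a + real n * h) =
    (\<Sum>i\<le>Suc n. hdiff_weight h \<alpha> (Suc n - i) * f (a + real i * h))"
proof -
  let ?w = "hsum_weight h (1 - \<alpha>)"
  have e: "fwd h (a + real n * h) = a + real (Suc n) * h"
    by (simp add: fwd_def algebra_simps)
  have "(\<Sum>i\<le>Suc n. hdiff_weight h \<alpha> (Suc n - i) * f (a + real i * h)) =
      (\<Sum>i\<le>n. (?w (Suc n - i) - ?w (n - i)) * f (a + real i * h) / h)
       + ?w 0 * f (a + real (Suc n) * h) / h"
    by (auto simp: hdiff_weight_def intro!: sum.cong)
  also have "\<dots> = ((\<Sum>i\<le>Suc n. ?w (Suc n - i) * f (a + real i * h))
      - (\<Sum>i\<le>n. ?w (n - i) * f (a + real i * h))) / h"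
    by (simp add: sum_divide_distrib sum_subtractf diff_divide_distrib add_divide_distrib left_diff_distrib)
  also have "\<dots> = left_hdiff h a \<alpha> f (a + real n * h)"
    by (simp only: left_hdiff_def delta_deriv_def e left_hsum_eq[OF assms])
  finally show ?thesis by simp
qed

text \<open>Here the step ahead removes a term, and the minus sign in the right difference
  makes the weights agree with those of the left one. The point \<open>t\<^sub>n\<^sub>+\<^sub>1\<close> must still lie in the
  grid, hence \<open>n < N\<close>.\<close>

lemma right_hdiff_eq:
  assumes "h > 0" "n < N"
  shows "right_hdiff h (a + real N * h) \<alpha> f (a + real n * h) =
    (\<Sum>i=n..N. hdiff_weight h \<alpha> (i - n) * f (a + real i * h))"
proof -
  let ?w = "hsum_weight h (1 - \<alpha>)"
  have e: "fwd h (a + real n * h) = a + real (Suc n) * h"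
    by (simp add: fwd_def algebra_simps)
  have "(\<Sum>i=n..N. hdiff_weight h \<alpha> (i - n) * f (a + real i * h)) =
      ?w 0 * f (a + real n * h) / h
      + (\<Sum>i=Suc n..N. (?w (i - n) - ?w (i - Suc n)) * f (a + real i * h) / h)"
    using assms by (subst sum.atLeast_Suc_atMost) (auto simp: hdiff_weight_def intro!: sum.cong)
  also have "\<dots> = - (((\<Sum>i=Suc n..N. ?w (i - Suc n) * f (a + real i * h))
      - (\<Sum>i=n..N. ?w (i - n) * f (a + real i * h))) / h)"
    using assms
    by (subst (2) sum.atLeast_Suc_atMost)
      (simp_all add: sum_divide_distrib sum_subtractf diff_divide_distrib add_divide_distrib left_diff_distrib)
  also have "\<dots> = right_hdiff h (a + real N * h) \<alpha> f (a + real n * h)"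
    using assms by (simp only: right_hdiff_def delta_deriv_def e right_hsum_eq less_imp_le Suc_leI)
  finally show ?thesis by simp
qed

lemma left_hdiff_add_mult:
  assumes "h > 0"
  shows "left_hdiff h a \<alpha> (\<lambda>t. y t + e * \<eta> t) (a + real n * h) =
    left_hdiff h a \<alpha> y (a + real n * h) + e * left_hdiff h a \<alpha> \<eta> (a + real n * h)"
  unfolding left_hdiff_eq[OF assms] sum_distrib_left sum.distrib[symmetric]
  by (intro sum.cong) (auto simp: algebra_simps)

lemma right_hdiff_add_mult:
  assumes "h > 0" "n < N"
  shows "right_hdiff h (a + real N * h) \<alpha> (\<lambda>t. y t + e * \<eta> t) (a + real n * h) =
    right_hdiff h (a + real N * h) \<alpha> y (a + real n * h)
      + e * right_hdiff h (a + real N * h) \<alpha> \<eta> (a + real n * h)"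
  unfolding right_hdiff_eq[OF assms] sum_distrib_left sum.distrib[symmetric]
  by (intro sum.cong) (auto simp: algebra_simps)

section \<open>Point variations and summation by parts\<close>

text \<open>The spike sits at \<open>t\<^sub>m\<^sub>+\<^sub>1\<close> because the functional sees a variation \<open>\<eta>\<close> through \<open>\<eta>\<^sup>\<sigma>\<close>, which is
  then supported at \<open>t\<^sub>m\<close>, the point at which the Euler--Lagrange equation is to be derived.\<close>

definition bump :: "real \<Rightarrow> real \<Rightarrow> nat \<Rightarrow> real \<Rightarrow> real" where
  "bump h a m t = of_bool (t = a + real (Suc m) * h)"

lemma bump_grid_point [simp]: "h > 0 \<Longrightarrow> bump h a m (a + real n * h) = of_bool (n = Suc m)"
  by (simp only: bump_def add_left_cancel mult_cancel_right of_nat_eq_iff) simp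

lemma bump_fwd [simp]: "h > 0 \<Longrightarrow> bump h a m (fwd h (a + real n * h)) = of_bool (n = m)"
  using bump_grid_point[of h a m "Suc n"] by (simp add: fwd_def algebra_simps)

lemma left_hdiff_bump:
  assumes "h > 0"
  shows "left_hdiff h a \<alpha> (bump h a m) (a + real n * h) =
    (if m \<le> n then hdiff_weight h \<alpha> (n - m) else 0)"
proof -
  have "left_hdiff h a \<alpha> (bump h a m) (a + real n * h) =
      (\<Sum>i\<le>Suc n. if i = Suc m then hdiff_weight h \<alpha> (Suc n - i) else 0)"
    unfolding left_hdiff_eq[OF assms] by (intro sum.cong) (auto simp: assms)
  then show ?thesis by simp
qed

lemma right_hdiff_bump:
  assumes "h > 0" "n < N" "Suc m \<le> N"
  shows "right_hdiff h (a + real N * h) \<alpha> (bump h a m) (a + real n * h) =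
    (if n \<le> Suc m then hdiff_weight h \<alpha> (Suc m - n) else 0)"
proof -
  have "right_hdiff h (a + real N * h) \<alpha> (bump h a m) (a + real n * h) =
      (\<Sum>i=n..N. if i = Suc m then hdiff_weight h \<alpha> (i - n) else 0)"
    unfolding right_hdiff_eq[OF assms(1,2)] by (intro sum.cong) (auto simp: assms)
  then show ?thesis using assms by simp
qed

text \<open>Tested against the bump, the left difference on \<open>\<T>\<close> leaves the weights \<open>n - m\<close> for
  \<open>m \<le> n < k\<close>. These form the right difference at \<open>t\<^sub>m\<close> on the grid that ends at
  \<open>t\<^sub>k\<^sub>-\<^sub>1 = \<rho>(b)\<close>: the range \<open>\<T>\<^sup>\<kappa>\<close> of the sum explains the end point \<open>\<rho>(b)\<close> in the equation.\<close>

lemma sum_times_left_hdiff_bump: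
  assumes "h > 0" "Suc m < k"
  shows "(\<Sum>n<k. g (a + real n * h) * left_hdiff h a \<alpha> (bump h a m) (a + real n * h)) =
    right_hdiff h (a + real (k - 1) * h) \<alpha> g (a + real m * h)"
proof -
  have "(\<Sum>n<k. g (a + real n * h) * left_hdiff h a \<alpha> (bump h a m) (a + real n * h)) =
      (\<Sum>n=m..k-1. g (a + real n * h) * left_hdiff h a \<alpha> (bump h a m) (a + real n * h))"
    using assms by (intro sum.mono_neutral_right) (auto simp: left_hdiff_bump)
  also have "\<dots> = right_hdiff h (a + real (k - 1) * h) \<alpha> g (a + real m * h)"
    using assms by (subst right_hdiff_eq) (auto simp: left_hdiff_bump intro!: sum.cong)
  finally show ?thesis .
qed

text \<open>The weights \<open>m + 1 - n\<close> for \<open>n \<le> m + 1\<close> are those of the left difference at \<open>t\<^sub>m\<close>;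
  all these \<open>n\<close> occur in the sum because \<open>m + 1 < k\<close>.\<close>

lemma sum_times_right_hdiff_bump:
  assumes "h > 0" "Suc m < k"
  shows "(\<Sum>n<k. g (a + real n * h) * right_hdiff h (a + real k * h) \<beta> (bump h a m) (a + real n * h)) =
    left_hdiff h a \<beta> g (a + real m * h)"
proof -
  have "(\<Sum>n<k. g (a + real n * h) * right_hdiff h (a + real k * h) \<beta> (bump h a m) (a + real n * h)) =
      (\<Sum>n\<le>Suc m. g (a + real n * h) * right_hdiff h (a + real k * h) \<beta> (bump h a m) (a + real n * h))"
    using assms by (intro sum.mono_neutral_right) (auto simp: right_hdiff_bump)
  also have "\<dots> = left_hdiff h a \<beta> g (a + real m * h)"
    unfolding left_hdiff_eq[OF assms(1)]
    using assms by (intro sum.cong) (auto simp: right_hdiff_bump)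
  finally show ?thesis .
qed

section \<open>The first variation\<close>

lemma functional_eq_sum:
  assumes "h > 0"
  shows "functional h a (a + real k * h) \<alpha> \<beta> L y =
    (\<Sum>n<k. along h a (a + real k * h) \<alpha> \<beta> L y (a + real n * h) * h)"
  using assms by (simp add: functional_def delta_integral_def)

lemma DERIV_functional:
  fixes a h :: real
  defines "x \<equiv> \<lambda>n::nat. a + real n * h"
  assumes h: "h > 0" and k: "k \<ge> 1" and b: "b = a + real k * h"
    and L: "cont_second_partials (hgrid h a (bwd h b)) L"
  shows "((\<lambda>e. functional h a b \<alpha> \<beta> L (\<lambda>t. y t + e * \<eta> t)) has_real_derivative
    (\<Sum>n<k. (along h a b \<alpha> \<beta> (d_u L) y (x n) * \<eta> (fwd h (x n))
      + along h a b \<alpha> \<beta> (d_v L) y (x n) * left_hdiff h a \<alpha> \<eta> (x n)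
      + along h a b \<alpha> \<beta> (d_w L) y (x n) * right_hdiff h b \<beta> \<eta> (x n)) * h)) (at 0)"
  unfolding b functional_eq_sum[OF h]
proof (intro DERIV_sum DERIV_cmult_right)
  fix n assume "n \<in> {..<k}"
  then have n: "n < k" by simp
  have "x n \<in> hgrid h a (bwd h b)"
    using n by (auto simp: b hgrid_bwd_eq_image[OF h k] x_def)
  from DERIV_lagrangian_line[OF L this]
  show "((\<lambda>e. along h a (a + real k * h) \<alpha> \<beta> L (\<lambda>t. y t + e * \<eta> t) (a + real n * h)) has_real_derivative
      along h a (a + real k * h) \<alpha> \<beta> (d_u L) y (x n) * \<eta> (fwd h (x n))
      + along h a (a + real k * h) \<alpha> \<beta> (d_v L) y (x n) * left_hdiff h a \<alpha> \<eta> (x n)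
      + along h a (a + real k * h) \<alpha> \<beta> (d_w L) y (x n)
          * right_hdiff h (a + real k * h) \<beta> \<eta> (x n)) (at 0)"
    using n by (simp add: along_def x_def left_hdiff_add_mult[OF h] right_hdiff_add_mult[OF h])
qed

text \<open>Small multiples of a variation are small in the norm that defines local minima.\<close>

lemma hnorm_mult:
  assumes h: "h > 0" and k: "k \<ge> 1" and b: "b = a + real k * h"
  shows "hnorm h a b \<alpha> \<beta> (\<lambda>t. e * \<eta> t) = \<bar>e\<bar> * hnorm h a b \<alpha> \<beta> \<eta>"
proof -
  let ?G = "hgrid h a (bwd h b)"
  have G: "?G = (\<lambda>n. a + real n * h) ` {..<k}"
    by (simp add: b hgrid_bwd_eq_image[OF h k])
  have Max_scale: "Max ((\<lambda>t. \<bar>F t\<bar>) ` ?G) = \<bar>e\<bar> * Max ((\<lambda>t. \<bar>f t\<bar>) ` ?G)"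
    if "\<And>t. t \<in> ?G \<Longrightarrow> F t = e * f t" for F f :: "real \<Rightarrow> real"
  proof -
    have "\<bar>e\<bar> * Max ((\<lambda>t. \<bar>f t\<bar>) ` ?G) = Max ((*) \<bar>e\<bar> ` (\<lambda>t. \<bar>f t\<bar>) ` ?G)"
      using k by (intro mono_Max_commute) (auto simp: G mono_def mult_left_mono lessThan_empty_iff)
    also have "(*) \<bar>e\<bar> ` (\<lambda>t. \<bar>f t\<bar>) ` ?G = (\<lambda>t. \<bar>F t\<bar>) ` ?G"
      unfolding image_image using that by (intro image_cong) (auto simp: abs_mult)
    finally show ?thesis by simp
  qed
  have left: "left_hdiff h a \<alpha> (\<lambda>t. e * \<eta> t) t = e * left_hdiff h a \<alpha> \<eta> t" if t: "t \<in> ?G" for t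
  proof -
    obtain n where "t = a + real n * h" using t by (auto simp: G)
    then show ?thesis
      by (simp only: left_hdiff_eq[OF h] sum_distrib_left mult.left_commute)
  qed
  have right: "right_hdiff h b \<beta> (\<lambda>t. e * \<eta> t) t = e * right_hdiff h b \<beta> \<eta> t" if t: "t \<in> ?G" for t
  proof -
    obtain n where "n < k" "t = a + real n * h" using t by (auto simp: G)
    then show ?thesis
      by (simp only: b right_hdiff_eq[OF h] sum_distrib_left mult.left_commute)
  qed
  have "hnorm h a b \<alpha> \<beta> (\<lambda>t. e * \<eta> t) =
      \<bar>e\<bar> * Max ((\<lambda>t. \<bar>\<eta> (fwd h t)\<bar>) ` ?G) + \<bar>e\<bar> * Max ((\<lambda>t. \<bar>left_hdiff h a \<alpha> \<eta> t\<bar>) ` ?G)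
      + \<bar>e\<bar> * Max ((\<lambda>t. \<bar>right_hdiff h b \<beta> \<eta> t\<bar>) ` ?G)"
    unfolding hnorm_def using left right by (intro arg_cong2[where f = "(+)"] Max_scale) auto
  then show ?thesis by (simp add: hnorm_def distrib_left)
qed

text \<open>By homogeneity of the norm, all sufficiently small \<open>e\<close> give admissible competitors within
  \<open>\<delta>\<close>, so Fermat's criterion for the real variable \<open>e\<close> applies.\<close>

lemma first_variation_eq_0:
  assumes h: "h > 0" and k: "k \<ge> 1" and b: "b = a + real k * h"
    and min: "local_minimum h a b \<alpha> \<beta> L A B yhat"
    and \<eta>: "\<eta> a = 0" "\<eta> b = 0"
    and D: "((\<lambda>e. functional h a b \<alpha> \<beta> L (\<lambda>t. yhat t + e * \<eta> t)) has_real_derivative D) (at 0)"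
  shows "D = 0"
proof -
  from min obtain \<delta> where \<delta>: "\<delta> > 0" and le: "\<And>y. y a = A \<Longrightarrow> y b = B \<Longrightarrow>
      hnorm h a b \<alpha> \<beta> (\<lambda>t. y t - yhat t) < \<delta> \<Longrightarrow>
      functional h a b \<alpha> \<beta> L yhat \<le> functional h a b \<alpha> \<beta> L y"
    and ends: "yhat a = A" "yhat b = B"
    by (auto simp: local_minimum_def)
  let ?N = "hnorm h a b \<alpha> \<beta> \<eta>"
  have pos: "\<bar>?N\<bar> + 1 > 0" by simp
  show ?thesis
  proof (rule DERIV_local_min[OF D])
    \<comment> \<open>the summand \<open>1\<close> keeps the quotient meaningful when the norm of \<open>\<eta>\<close> is \<open>0\<close>\<close>
    show "\<delta> / (\<bar>?N\<bar> + 1) > 0" using \<delta> pos by simp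
    show "\<forall>e. \<bar>0 - e\<bar> < \<delta> / (\<bar>?N\<bar> + 1) \<longrightarrow>
        functional h a b \<alpha> \<beta> L (\<lambda>t. yhat t + 0 * \<eta> t) \<le> functional h a b \<alpha> \<beta> L (\<lambda>t. yhat t + e * \<eta> t)"
    proof (intro allI impI)
      fix e assume "\<bar>0 - e\<bar> < \<delta> / (\<bar>?N\<bar> + 1)"
      then have "\<bar>e\<bar> * (\<bar>?N\<bar> + 1) < \<delta>" using pos by (simp add: pos_less_divide_eq)
      moreover have "\<bar>e\<bar> * ?N \<le> \<bar>e\<bar> * (\<bar>?N\<bar> + 1)" by (intro mult_left_mono) auto
      ultimately have "hnorm h a b \<alpha> \<beta> (\<lambda>t. e * \<eta> t) < \<delta>"
        by (simp add: hnorm_mult[OF h k b])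
      then show "functional h a b \<alpha> \<beta> L (\<lambda>t. yhat t + 0 * \<eta> t) \<le>
          functional h a b \<alpha> \<beta> L (\<lambda>t. yhat t + e * \<eta> t)"
        using le[of "\<lambda>t. yhat t + e * \<eta> t"] \<eta> ends by simp
    qed
  qed
qed

section \<open>The Euler--Lagrange equation\<close>

theorem theorem3p5:
  fixes a h b A B \<alpha> \<beta> :: real
    and k :: nat
    and L :: "real \<Rightarrow> real \<Rightarrow> real \<Rightarrow> real \<Rightarrow> real"
    and yhat :: "real \<Rightarrow> real"
  assumes "h > 0" and "k \<ge> 1" and "b = a + real k * h"
    and "\<alpha> \<in> {0<..1}" and "\<beta> \<in> {0<..1}"
    and "cont_second_partials (hgrid h a (bwd h b)) L"
    and "local_minimum h a b \<alpha> \<beta> L A B yhat"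
  shows "\<forall>t\<in>hgrid h a (bwd h (bwd h b)).
           along h a b \<alpha> \<beta> (d_u L) yhat t
           + right_hdiff h (bwd h b) \<alpha> (along h a b \<alpha> \<beta> (d_v L) yhat) t
           + left_hdiff h a \<beta> (along h a b \<alpha> \<beta> (d_w L) yhat) t = 0"
proof
  note h = assms(1) and k = assms(2) and b = assms(3)
  let ?U = "along h a b \<alpha> \<beta> (d_u L) yhat" and ?V = "along h a b \<alpha> \<beta> (d_v L) yhat"
    and ?W = "along h a b \<alpha> \<beta> (d_w L) yhat"
  fix t assume "t \<in> hgrid h a (bwd h (bwd h b))"
  then obtain m where t: "t = a + real m * h" and "t + 2 * h \<le> b"
    by (auto simp: hgrid_def bwd_def)
  then have "real (m + 2) * h \<le> real k * h" by (simp add: b algebra_simps)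
  then have m: "Suc m < k" using h by (simp only: mult_le_cancel_right_pos of_nat_le_iff)
  have bwd_b: "bwd h b = a + real (k - 1) * h"
    unfolding b by (rule bwd_grid_point[OF k])
  \<comment> \<open>\<open>t\<^sub>m\<^sub>+\<^sub>1\<close> lies strictly between \<open>a\<close> and \<open>b\<close>, so this variation vanishes at both ends\<close>
  let ?\<eta> = "bump h a m"
  have "?\<eta> a = 0" "?\<eta> b = 0"
    using bump_grid_point[OF h, of a m 0] bump_grid_point[OF h, of a m k] m by (simp_all add: b)
  from first_variation_eq_0[OF h k b assms(7) this DERIV_functional[OF h k b assms(6)]]
  have "0 = h * (\<Sum>n<k. ?U (a + real n * h) * ?\<eta> (fwd h (a + real n * h))
      + ?V (a + real n * h) * left_hdiff h a \<alpha> ?\<eta> (a + real n * h)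
      + ?W (a + real n * h) * right_hdiff h b \<beta> ?\<eta> (a + real n * h))"
    by (simp add: sum_distrib_left mult_ac)
  also have "(\<Sum>n<k. ?U (a + real n * h) * ?\<eta> (fwd h (a + real n * h))
      + ?V (a + real n * h) * left_hdiff h a \<alpha> ?\<eta> (a + real n * h)
      + ?W (a + real n * h) * right_hdiff h b \<beta> ?\<eta> (a + real n * h))
    = ?U t + right_hdiff h (bwd h b) \<alpha> ?V t + left_hdiff h a \<beta> ?W t"
  proof -
    have "(\<Sum>n<k. ?U (a + real n * h) * ?\<eta> (fwd h (a + real n * h))) = ?U t"
      using h m by (simp add: t)
    moreover have "(\<Sum>n<k. ?V (a + real n * h) * left_hdiff h a \<alpha> ?\<eta> (a + real n * h)) =
        right_hdiff h (bwd h b) \<alpha> ?V t"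
      unfolding bwd_b t by (rule sum_times_left_hdiff_bump[OF h m])
    moreover have "(\<Sum>n<k. ?W (a + real n * h) * right_hdiff h b \<beta> ?\<eta> (a + real n * h)) =
        left_hdiff h a \<beta> ?W t"
      using sum_times_right_hdiff_bump[OF h m, of ?W a \<beta>] by (simp add: b t)
    ultimately show ?thesis by (simp add: sum.distrib)
  qed
  finally show "?U t + right_hdiff h (bwd h b) \<alpha> ?V t + left_hdiff h a \<beta> ?W t = 0"
    using h by simp
qed

end
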